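(* Let $X$ be a real Hilbert space, let $Z$ be a nonempty closed convex subset of $X$, and let $(x_n)_{n\in\mathbb{N}}$ be a sequence in $X$ that is Fejér monotone with respect to $Z$. Suppose that $(x_{k_n})_{n\in\mathbb{N}}$ is a subsequence of $(x_n)_{n\in\mathbb{N}}$ that converges strongly to some $\bar z\in X$ and that, for every $n\in\mathbb{N}$, $x_{k_{n+1}}\neq x_{k_n}$ and $x_{k_n}\neq\bar z$. Then $$\mathcal{C}\left(\left(\frac{x_{k_n}-x_{k_{n+1}}}{\|x_{k_n}-x_{k_{n+1}}\|}\right)_{n\in\mathbb{N}}\right)\cup \mathcal{C}\left(\left(\frac{x_{k_n}-\bar z}{\|x_{k_n}-\bar z\|}\right)_{n\in\mathbb{N}}\right)\subseteq (Z-\bar z)^{\ominus}.$$ In particular, if $\bar z\in Z$, then $(Z-\bar z)^{\ominus}$ may be replaced by $N_Z(\bar z)$ in this inclusion.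
   Context: $X$ is a real Hilbert space with inner product $\langle\cdot,\cdot\rangle$ and induced norm $\|\cdot\|$; $\mathbb{N}=\{0,1,2,\ldots\}$. A sequence $(x_n)_{n\in\mathbb{N}}$ in $X$ is Fejér monotone with respect to $C\subseteq X$ if $\|x_{n+1}-c\|\le\|x_n-c\|$ for all $c\in C$ and all $n\in\mathbb{N}$. For a sequence $(y_n)_{n\in\mathbb{N}}$ in $X$, $\mathcal{C}((y_n)_{n\in\mathbb{N}})$ denotes the set of its weak cluster points, i.e. of all $y\in X$ that are the weak limit of some subsequence of $(y_n)_{n\in\mathbb{N}}$. For $C\subseteq X$, the polar cone is $C^{\ominus}=\{u\in X : \sup_{c\in C}\langle c,u\rangle\le 0\}$. If $z\in C$, the normal cone of $C$ at $z$ is $N_C(z)=(C-z)^{\ominus}$. *)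

theory Defs
  imports "HOL-Analysis.Analysis"
begin

definition fejer_monotone :: "(nat \<Rightarrow> 'a::real_inner) \<Rightarrow> 'a set \<Rightarrow> bool" where
  "fejer_monotone x C \<longleftrightarrow> (\<forall>c\<in>C. \<forall>n. norm (x (Suc n) - c) \<le> norm (x n - c))"

(* By the Riesz representation theorem, in a Hilbert space the functionals
   y \<mapsto> inner y u are exactly the continuous linear functionals. *)
definition weakly_tendsto :: "(nat \<Rightarrow> 'a::real_inner) \<Rightarrow> 'a \<Rightarrow> bool" where
  "weakly_tendsto y l \<longleftrightarrow> (\<forall>u. (\<lambda>n. inner (y n) u) \<longlonglongrightarrow> inner l u)"

definition weak_cluster_points :: "(nat \<Rightarrow> 'a::real_inner) \<Rightarrow> 'a set" where
  "weak_cluster_points y = {l. \<exists>r. strict_mono r \<and> weakly_tendsto (y \<circ> r) l}"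

(* The supremum is taken in the extended reals, since it may be infinite. *)
definition polar_cone :: "'a::real_inner set \<Rightarrow> 'a set" where
  "polar_cone C = {u. (SUP c\<in>C. ereal (inner c u)) \<le> 0}"

(* The value for z outside C is the usual convention of convex analysis. *)
definition normal_cone :: "'a::real_inner set \<Rightarrow> 'a \<Rightarrow> 'a set" where
  "normal_cone C z = (if z \<in> C then polar_cone ((\<lambda>c. c - z) ` C) else {})"

end

theory Submission
  imports Defs
begin

text \<open>
  If a step from a point \<open>p\<close> to another point \<open>q\<close> does not increase the distance to \<open>z\<close>, then \<open>z\<close>
  lies in the closed half-space that contains \<open>q\<close> and is bounded by the perpendicular bisector of
  the segment from \<open>p\<close> to \<open>q\<close>, and so \<open>inner (p - q) (z - midpoint p q) \<le> 0\<close>. If \<open>p\<close> and \<open>q\<close> run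
  through sequences with the common strong limit \<open>zbar\<close>, the midpoints tend strongly to \<open>zbar\<close> while
  the normalized differences remain in the closed unit ball. The midpoint may therefore be replaced
  by \<open>zbar\<close> at the cost of an error that vanishes in the limit, and every weak cluster point of the
  normalized differences lies in the polar cone of \<open>Z - zbar\<close>
  (lemma \<open>weak_cluster_points_of_fejer_steps_in_polar_cone\<close>).

  Both families of directions are of this kind. Fejer monotonicity makes each passage from
  \<open>x (k n)\<close> to \<open>x (k (Suc n))\<close> such a step, and also the passage from \<open>x (k n)\<close> to \<open>zbar\<close>, because the
  distance from \<open>zbar\<close> to a point of \<open>Z\<close> is the limit of the nonincreasing distances along the
  subsequence.
\<close>

lemma mem_polar_cone_iff: "u \<in> polar_cone C \<longleftrightarrow> (\<forall>c\<in>C. inner c u \<le> 0)"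
  by (simp add: polar_cone_def SUP_le_iff)

text \<open>
  The quantitative form of the perpendicular-bisector argument. The inequality between the distances
  is equivalent to \<open>inner (p - q) (z - midpoint p q) \<le> 0\<close>; trading the midpoint for an
  arbitrary point \<open>w\<close> costs at most the distance between the two, by the Cauchy-Schwarz inequality.
\<close>

lemma inner_unit_step_le_dist_midpoint:
  fixes p q z w :: "'a::real_inner"
  assumes "norm (q - z) \<le> norm (p - z)"
  shows "inner ((p - q) /\<^sub>R norm (p - q)) (z - w) \<le> norm (midpoint p q - w)"
proof -
  let ?d = "(p - q) /\<^sub>R norm (p - q)"
  have "inner (q - z) (q - z) \<le> inner (p - z) (p - z)"
    using assms by (simp add: norm_le)
  moreover have "inner (p - z) (p - z) - inner (q - z) (q - z)
      = - 2 * inner (p - q) (z - midpoint p q)"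
    by (simp add: midpoint_def inner_diff_left inner_diff_right inner_add_right
        inner_commute field_simps)
  ultimately have "inner (p - q) (z - midpoint p q) \<le> 0"
    by linarith
  then have "inner ?d (z - midpoint p q) \<le> 0"
    by (simp add: mult_nonneg_nonpos)
  moreover have "inner ?d (midpoint p q - w) \<le> norm ?d * norm (midpoint p q - w)"
    by (rule norm_cauchy_schwarz)
  \<comment> \<open>An inequality, since \<open>?d\<close> is zero when \<open>p = q\<close>.\<close>
  moreover have "norm ?d \<le> 1"
    by (cases "p = q") simp_all
  then have "norm ?d * norm (midpoint p q - w) \<le> norm (midpoint p q - w)"
    by (intro mult_left_le_one_le) simp_all
  moreover have "inner ?d (z - w) = inner ?d (z - midpoint p q) + inner ?d (midpoint p q - w)"
    by (simp add: inner_diff_right)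
  ultimately show ?thesis
    by linarith
qed

text \<open>
  Strong convergence to a common limit is what makes this work under merely weak convergence of the
  directions: the bounded directions are paired with midpoints that converge in norm.
\<close>

lemma weak_cluster_points_of_fejer_steps_in_polar_cone:
  fixes p q :: "nat \<Rightarrow> 'a::real_inner"
  assumes p: "p \<longlonglongrightarrow> w" and q: "q \<longlonglongrightarrow> w"
    and closer: "\<And>n z. z \<in> Z \<Longrightarrow> norm (q n - z) \<le> norm (p n - z)"
  shows "weak_cluster_points (\<lambda>n. (p n - q n) /\<^sub>R norm (p n - q n))
         \<subseteq> polar_cone ((\<lambda>z. z - w) ` Z)"
proof
  fix l
  assume "l \<in> weak_cluster_points (\<lambda>n. (p n - q n) /\<^sub>R norm (p n - q n))"
  then obtain r where r: "strict_mono r"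
    and weak: "weakly_tendsto ((\<lambda>n. (p n - q n) /\<^sub>R norm (p n - q n)) \<circ> r) l"
    by (auto simp: weak_cluster_points_def)
  have "(\<lambda>n. midpoint (p n) (q n)) \<longlonglongrightarrow> midpoint w w"
    unfolding midpoint_def by (intro tendsto_intros p q)
  then have "(\<lambda>n. norm (midpoint (p n) (q n) - w)) \<longlonglongrightarrow> 0"
    by (simp add: LIM_zero tendsto_norm_zero)
  then have midpoints: "(\<lambda>n. norm (midpoint (p (r n)) (q (r n)) - w)) \<longlonglongrightarrow> 0"
    using LIMSEQ_subseq_LIMSEQ[OF _ r] by (fastforce simp: o_def)
  have "inner l (z - w) \<le> 0" if "z \<in> Z" for z
  proof (rule LIMSEQ_le[OF _ midpoints])
    show "(\<lambda>n. inner ((p (r n) - q (r n)) /\<^sub>R norm (p (r n) - q (r n))) (z - w))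
          \<longlonglongrightarrow> inner l (z - w)"
      using weak unfolding weakly_tendsto_def o_def by blast
    show "\<exists>N. \<forall>n\<ge>N. inner ((p (r n) - q (r n)) /\<^sub>R norm (p (r n) - q (r n))) (z - w)
          \<le> norm (midpoint (p (r n)) (q (r n)) - w)"
      using inner_unit_step_le_dist_midpoint closer that by blast
  qed
  then show "l \<in> polar_cone ((\<lambda>z. z - w) ` Z)"
    by (simp add: mem_polar_cone_iff inner_commute)
qed

lemma fejer_monotone_decseq:
  assumes "fejer_monotone x C" "c \<in> C"
  shows "decseq (\<lambda>n. norm (x n - c))"
  using assms by (simp add: fejer_monotone_def decseq_Suc_iff)

theorem corollary3p2:
  fixes Z :: "'a::{real_inner, complete_space} set"
    and x :: "nat \<Rightarrow> 'a"
    and k :: "nat \<Rightarrow> nat"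
    and zbar :: 'a
  assumes "Z \<noteq> {}" and "closed Z" and "convex Z"
    and "fejer_monotone x Z"
    and "strict_mono k"
    and "(\<lambda>n. x (k n)) \<longlonglongrightarrow> zbar"
    and "\<And>n. x (k (Suc n)) \<noteq> x (k n)"
    and "\<And>n. x (k n) \<noteq> zbar"
  shows "(weak_cluster_points (\<lambda>n. (x (k n) - x (k (Suc n))) /\<^sub>R norm (x (k n) - x (k (Suc n))))
          \<union> weak_cluster_points (\<lambda>n. (x (k n) - zbar) /\<^sub>R norm (x (k n) - zbar))
          \<subseteq> polar_cone ((\<lambda>z. z - zbar) ` Z)) \<and>
         (zbar \<in> Z \<longrightarrow>
          weak_cluster_points (\<lambda>n. (x (k n) - x (k (Suc n))) /\<^sub>R norm (x (k n) - x (k (Suc n))))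
          \<union> weak_cluster_points (\<lambda>n. (x (k n) - zbar) /\<^sub>R norm (x (k n) - zbar))
          \<subseteq> normal_cone Z zbar)"
proof -
  let ?polar = "polar_cone ((\<lambda>z. z - zbar) ` Z)"
  have dec: "decseq (\<lambda>n. norm (x (k n) - z))" if "z \<in> Z" for z
    using fejer_monotone_decseq[OF \<open>fejer_monotone x Z\<close> that] strict_mono_mono[OF \<open>strict_mono k\<close>]
    by (simp add: monotone_def)
  have next_closer: "norm (x (k (Suc n)) - z) \<le> norm (x (k n) - z)" if "z \<in> Z" for n z
    using decseq_SucD[OF dec[OF that]] .
  have limit_closer: "norm (zbar - z) \<le> norm (x (k n) - z)" if "z \<in> Z" for n z
    by (rule decseq_ge[OF dec[OF that]])
      (intro tendsto_intros \<open>(\<lambda>n. x (k n)) \<longlonglongrightarrow> zbar\<close>)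
  have "weak_cluster_points (\<lambda>n. (x (k n) - x (k (Suc n))) /\<^sub>R norm (x (k n) - x (k (Suc n))))
        \<subseteq> ?polar"
    using \<open>(\<lambda>n. x (k n)) \<longlonglongrightarrow> zbar\<close> LIMSEQ_Suc[OF \<open>(\<lambda>n. x (k n)) \<longlonglongrightarrow> zbar\<close>] next_closer
    by (rule weak_cluster_points_of_fejer_steps_in_polar_cone)
  moreover have "weak_cluster_points (\<lambda>n. (x (k n) - zbar) /\<^sub>R norm (x (k n) - zbar)) \<subseteq> ?polar"
    using \<open>(\<lambda>n. x (k n)) \<longlonglongrightarrow> zbar\<close> tendsto_const limit_closer
    by (rule weak_cluster_points_of_fejer_steps_in_polar_cone)
  ultimately show ?thesis
    by (simp add: normal_cone_def)
qed

end
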